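(* $\kappa_{\mathrm{BP}}\le\mathfrak{d}(R^{\mathrm{sPP}})$.
   Context: For a perfect set $P\subseteq 2^\omega$ and $X\subseteq\omega$, $P\restriction X=\{f\in 2^X:(\exists g\in P)(f\subseteq g)\}$. The Balcerzak–Plewik number $\kappa_{\mathrm{BP}}$ is the minimal size of a family $\mathcal{K}\subseteq[\omega]^\omega$ such that for some perfect set $Q\subseteq 2^\omega$, for every perfect $P\subseteq Q$ there is $X\in\mathcal{K}$ with $P\restriction X=2^X$. Let $\mathcal{X}$ be the set of sequences $\bar w=\langle w_i:i\in B\rangle$ with $B\in[\omega]^\omega$ and $w_i\in[\omega]^i$ for $i\in B$. The relation $R^{\mathrm{sPP}}\subseteq\omega^\omega\times\mathcal{X}$: $(\eta,\bar w)\in R^{\mathrm{sPP}}$ iff $\eta(i)\in w_i$ for all $i\in\mathrm{dom}(\bar w)$. $\mathfrak{d}(R^{\mathrm{sPP}})$ is the least size of $D\subseteq\mathcal{X}$ such that for every $\eta\in\omega^\omega$ there is $\bar w\in D$ with $(\eta,\bar w)\in R^{\mathrm{sPP}}$. *)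

theory Defs
  imports "HOL-Analysis.Analysis"
begin

unbundle cardinal_syntax

text \<open>
  The least cardinality of a member of the family \<open>F\<close>, as a cardinal in the sense of the
  \<open>\<le>o\<close> order.  It is unique up to \<open>=o\<close>, and it is meaningful only if \<open>F\<close> is nonempty
  (see the lemma below), as with any minimum.
\<close>

definition least_card :: "'a set set \<Rightarrow> 'a rel" where
  "least_card F = (SOME r. r \<in> card_of ` F \<and> (\<forall>K\<in>F. r \<le>o |K| ))"

lemma least_card:
  assumes "F \<noteq> {}"
  shows "least_card F \<in> card_of ` F \<and> (\<forall>K\<in>F. least_card F \<le>o |K| )"
proof -
  have "\<exists>r\<in>card_of ` F. \<forall>r'\<in>card_of ` F. r \<le>o r'"
    using assms by (intro exists_minim_Card_order) (auto intro: card_of_Card_order)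
  then have "\<exists>r. r \<in> card_of ` F \<and> (\<forall>K\<in>F. r \<le>o |K| )"
    by blast
  then show ?thesis
    unfolding least_card_def by (rule someI_ex)
qed

text \<open>
  The Cantor space is \<open>nat \<Rightarrow> bool\<close> with its product topology (\<open>bool\<close> being discrete).
  Perfect sets are nonempty by convention.
\<close>

definition perfect_set :: "(nat \<Rightarrow> bool) set \<Rightarrow> bool" where
  "perfect_set P \<longleftrightarrow> P \<noteq> {} \<and> closed P \<and> (\<forall>x\<in>P. x islimpt P)"

text \<open>
  A function with domain \<open>X\<close> is represented by the extensional function space
  \<open>X \<rightarrow>\<^sub>E UNIV\<close>, so that inclusion \<open>f \<subseteq> g\<close> of graphs is agreement on \<open>X\<close>.
\<close>

definition restr_set :: "(nat \<Rightarrow> bool) set \<Rightarrow> nat set \<Rightarrow> (nat \<Rightarrow> bool) set" where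
  "restr_set P X = {f \<in> X \<rightarrow>\<^sub>E (UNIV :: bool set). \<exists>g\<in>P. \<forall>n\<in>X. f n = g n}"

definition BP_families :: "nat set set set" where
  "BP_families =
    {\<K>. (\<forall>X\<in>\<K>. infinite X) \<and>
         (\<exists>Q. perfect_set Q \<and>
              (\<forall>P. perfect_set P \<and> P \<subseteq> Q \<longrightarrow>
                   (\<exists>X\<in>\<K>. restr_set P X = (X \<rightarrow>\<^sub>E (UNIV :: bool set)))))}"

definition kappa_BP :: "nat set rel" where
  "kappa_BP = least_card BP_families"

text \<open>A sequence indexed by an infinite set \<open>B\<close> of naturals is a partial function with domain \<open>B\<close>.\<close>

definition sPP_slaloms :: "(nat \<rightharpoonup> nat set) set" where
  "sPP_slaloms =
    {w. infinite (dom w) \<and> (\<forall>i\<in>dom w. finite (the (w i)) \<and> card (the (w i)) = i)}"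

definition R_sPP :: "((nat \<Rightarrow> nat) \<times> (nat \<rightharpoonup> nat set)) set" where
  "R_sPP = {(\<eta>, w). w \<in> sPP_slaloms \<and> (\<forall>i\<in>dom w. \<eta> i \<in> the (w i))}"

definition d_R_sPP :: "(nat \<rightharpoonup> nat set) rel" where
  "d_R_sPP = least_card {D. D \<subseteq> sPP_slaloms \<and> (\<forall>\<eta>. \<exists>w\<in>D. (\<eta>, w) \<in> R_sPP)}"

end

theory Submission
  imports Defs
begin

text \<open>
  Let \<open>Q\<close> be a perfect set that is independent as a family of subsets of \<open>\<omega>\<close>.
  A perfect \<open>P \<subseteq> Q\<close> corresponds to a perfect tree \<open>T\<close>; choose levels \<open>m 0 \<le> m 1 \<le> \<dots>\<close> such that
  every node at level \<open>m i\<close> has very many extensions at level \<open>m (i + 1)\<close>, and let \<open>\<eta> i\<close> code the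
  \<open>m i\<close>-th level of \<open>T\<close>.  A slalom \<open>w\<close> capturing \<open>\<eta>\<close> offers at the \<open>s\<close>-th element \<open>i\<close> of its domain
  only \<open>i\<close> candidates for this level.  From \<open>w\<close> alone one therefore chooses a coordinate that
  simultaneously splits, in every candidate, the nodes realizing each of the \<open>2 ^ s\<close> patterns
  on the coordinates chosen before.  The chosen coordinates form a set \<open>X\<close> on which \<open>P\<close> realizes
  every finite pattern, hence, by compactness, every pattern.
\<close>

section \<open>Initial segments and the choice of incompatible strings\<close>

definition init :: "(nat \<Rightarrow> bool) \<Rightarrow> nat \<Rightarrow> bool list" where
  "init y m = map y [0..<m]"

definition extends :: "(nat \<Rightarrow> bool) \<Rightarrow> bool list \<Rightarrow> bool" where
  "extends y t \<longleftrightarrow> init y (length t) = t"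

lemma length_init [simp]: "length (init y m) = m"
  by (simp add: init_def)

lemma init_eq_iff: "init y m = init z m \<longleftrightarrow> (\<forall>i<m. y i = z i)"
  by (auto simp: init_def)

lemma take_init: "m \<le> n \<Longrightarrow> take m (init y n) = init y m"
  by (simp add: init_def take_map)

lemma extends_init_iff: "extends z (init y m) \<longleftrightarrow> (\<forall>i<m. z i = y i)"
  by (simp add: extends_def init_eq_iff)

lemma ex_extends: "\<exists>y. extends y t"
  by (rule exI[of _ "\<lambda>i. t ! i"]) (auto simp: extends_def init_def intro: nth_equalityI)

lemma finite_init_image: "finite ((\<lambda>y. init y m) ` R)"
  by (rule finite_subset[OF _ finite_lists_length_eq[of UNIV m]]) auto

text \<open>
  Strings are chosen in order of decreasing length: a string chosen earlier is then comparable
  with at most one string of the current length.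
\<close>

lemma incompatible_choice:
  fixes F :: "'r \<Rightarrow> bool list set"
  assumes "finite R" and "card R \<le> N"
    and "\<And>r t. r \<in> R \<Longrightarrow> t \<in> F r \<Longrightarrow> length t = l r"
    and "\<And>r. r \<in> R \<Longrightarrow> finite (F r) \<and> N \<le> card (F r)"
  shows "\<exists>p. \<forall>r\<in>R. p r \<in> F r \<and> (\<forall>q\<in>R. q \<noteq> r \<longrightarrow> \<not> (\<exists>y. extends y (p r) \<and> extends y (p q)))"
  using assms
\<comment> \<open>This induction adds an element of greatest rank; negating the length makes that a
  shortest one.\<close>
proof (induction R rule: finite_ranking_induct[where f = "\<lambda>r. - int (l r)"])
  case empty
  then show ?case by simp
next
  case (insert r R)
  show ?case
  proof (cases "r \<in> R")
    case True
    then show ?thesis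
      using insert by (metis insert_absorb)
  next
    case False
    have cardR: "card R < N"
      using insert.prems(1) insert.hyps(1) False by simp
    have "\<exists>p. \<forall>r\<in>R. p r \<in> F r \<and> (\<forall>q\<in>R. q \<noteq> r \<longrightarrow> \<not> (\<exists>y. extends y (p r) \<and> extends y (p q)))"
      using cardR insert.prems by (intro insert.IH) auto
    then obtain p where p: "\<And>r. r \<in> R \<Longrightarrow> p r \<in> F r"
      "\<And>r q. r \<in> R \<Longrightarrow> q \<in> R \<Longrightarrow> q \<noteq> r \<Longrightarrow> \<not> (\<exists>y. extends y (p r) \<and> extends y (p q))"
      by blast
    \<comment> \<open>The blocked strings: truncating each earlier, longer string leaves the only
      string of length \<open>l r\<close> compatible with it. There are fewer than \<open>N\<close>
      of them, so some member of \<open>F r\<close> is not blocked.\<close>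
    define Bl where "Bl = (\<lambda>q. take (l r) (p q)) ` R"
    have "card Bl < card (F r)"
      using card_image_le[OF insert.hyps(1), of "\<lambda>q. take (l r) (p q)"] cardR insert.prems(3)[of r]
      unfolding Bl_def by simp
    then have "\<not> F r \<subseteq> Bl"
      using insert.hyps(1) card_mono[of Bl "F r"] by (auto simp: Bl_def)
    then obtain a where a: "a \<in> F r" "a \<notin> Bl" by blast
    have inc: "\<not> (\<exists>y. extends y a \<and> extends y (p q))" if q: "q \<in> R" for q
    proof
      assume "\<exists>y. extends y a \<and> extends y (p q)"
      then obtain y where y: "init y (length a) = a" "init y (length (p q)) = p q"
        by (auto simp: extends_def)
      have "length a \<le> length (p q)"
        using insert.hyps(2)[OF q] insert.prems(2)[of r a] insert.prems(2)[of q "p q"] a p(1)[OF q] q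
        by simp
      then have "take (length a) (p q) = a"
        using y by (metis take_init)
      then show False
        using a q insert.prems(2)[of r a] unfolding Bl_def by auto
    qed
    show ?thesis
    proof (rule exI[of _ "p(r := a)"], intro ballI conjI impI)
      fix s assume "s \<in> insert r R"
      then show "(p(r := a)) s \<in> F s"
        using a p by auto
    next
      fix s q assume "s \<in> insert r R" "q \<in> insert r R" "q \<noteq> s"
      then show "\<not> (\<exists>y. extends y ((p(r := a)) s) \<and> extends y ((p(r := a)) q))"
        using inc p(2) False by (metis fun_upd_other fun_upd_same insertE)
    qed
  qed
qed

section \<open>Coordinates as codes of clopen sets, and the splitting of guesses\<close>

text \<open>
  A coordinate codes a finite list of strings, i.e. a clopen set; the additional natural number
  gives every clopen set infinitely many codes.  The range of \<open>cone_trace\<close> is the set \<open>Q\<close>.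
\<close>

definition cone_trace :: "(nat \<Rightarrow> bool) \<Rightarrow> nat \<Rightarrow> bool" where
  "cone_trace y n \<longleftrightarrow> (\<exists>t\<in>set (snd (from_nat n :: nat \<times> bool list list)). extends y t)"

lemma ex_coordinate:
  assumes "finite A" "finite Y"
  shows "\<exists>n. n \<notin> Y \<and> (\<forall>y. cone_trace y n \<longleftrightarrow> (\<exists>t\<in>A. extends y t))"
proof -
  obtain as where as: "set as = A"
    using finite_list[OF assms(1)] by blast
  have "inj (\<lambda>k::nat. to_nat (k, as))"
    by (auto simp: inj_on_def)
  then have "infinite (range (\<lambda>k::nat. to_nat (k, as)))"
    by (rule range_inj_infinite)
  then obtain n where "n \<in> range (\<lambda>k::nat. to_nat (k, as))" "n \<notin> Y"
    using assms(2) by (meson finite_subset subsetI)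
  then show ?thesis
    using as by (intro exI[of _ n]) (auto simp: cone_trace_def)
qed

text \<open>Quantifying over all branches through \<open>t\<close> lets the string alone decide the
  pattern, so that a guessed level can be examined without knowing \<open>P\<close>.\<close>

definition forces :: "bool list \<Rightarrow> nat list \<Rightarrow> bool list \<Rightarrow> bool" where
  "forces t xs \<sigma> \<longleftrightarrow> (\<forall>y. extends y t \<longrightarrow> map (cone_trace y) xs = \<sigma>)"

lemma forces_init_mono:
  "forces (init y m) xs \<sigma> \<Longrightarrow> m \<le> n \<Longrightarrow> (\<forall>i<m. z i = y i) \<Longrightarrow> forces (init z n) xs \<sigma>"
  by (auto simp: forces_def extends_init_iff)

lemma forces_initD: "forces (init y m) xs \<sigma> \<Longrightarrow> map (cone_trace y) xs = \<sigma>"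
  by (simp add: forces_def extends_init_iff)

text \<open>Every natural number decodes to a finite set of strings, so each candidate offered by a
  slalom can be read as a guess. Guesses with strings of unequal length do occur;
  \<open>splits_next\<close> filters them out.\<close>

definition level_of :: "nat \<Rightarrow> bool list set" where
  "level_of c = set (from_nat c :: bool list list)"

lemma ex_level_code: "finite A \<Longrightarrow> \<exists>c. level_of c = A"
  unfolding level_of_def by (metis finite_list from_nat_to_nat)

text \<open>
  The elements of \<open>W\<close> are guesses for a level of the tree of a perfect set.  The bound on the
  cardinality is the number of triples of a guess, a pattern on \<open>xs\<close> and a value at \<open>n\<close>: for each
  of them one string has to be chosen, all of them pairwise incompatible.
\<close>

definition splits_next :: "nat set \<Rightarrow> nat list \<Rightarrow> nat \<Rightarrow> bool" where
  "splits_next W xs n \<longleftrightarrow> n \<notin> set xs \<and>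
     (\<forall>c\<in>W. \<forall>\<sigma> b. (\<exists>m. \<forall>t\<in>level_of c. length t = m) \<longrightarrow> length \<sigma> = length xs \<longrightarrow>
        card W * 2 ^ length xs * 2 \<le> card {t \<in> level_of c. forces t xs \<sigma>} \<longrightarrow>
        (\<exists>t\<in>level_of c. forces t (xs @ [n]) (\<sigma> @ [b])))"

text \<open>Let \<open>n\<close> code the union of the cones over the strings chosen for triples
  with value \<open>True\<close>. By incompatibility, the cone over a string chosen for a triple
  with value \<open>False\<close> is disjoint from this union, so each chosen string forces its
  prescribed value at \<open>n\<close>.\<close>

lemma ex_splits_next:
  assumes "finite W"
  shows "\<exists>n. splits_next W xs n"
proof -
  define F where "F = (\<lambda>(c, \<sigma>, b::bool). {t \<in> level_of c. forces t xs \<sigma>})"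
  define N where "N = card W * 2 ^ length xs * 2"
  define S where "S = W \<times> {\<sigma>::bool list. length \<sigma> = length xs} \<times> (UNIV :: bool set)"
  define R where "R = {r \<in> S. (\<exists>m. \<forall>t\<in>level_of (fst r). length t = m) \<and> N \<le> card (F r)}"
  have fl: "finite {\<sigma>::bool list. length \<sigma> = length xs}"
    and cl: "card {\<sigma>::bool list. length \<sigma> = length xs} = 2 ^ length xs"
    using finite_lists_length_eq[of "UNIV :: bool set" "length xs"]
      card_lists_length_eq[of "UNIV :: bool set" "length xs"] by (auto simp: card_UNIV_bool)
  have finS: "finite S"
    using fl assms by (simp add: S_def)
  have "card S = N"
    by (simp add: S_def N_def card_cartesian_product cl)
  then have cardR: "card R \<le> N"
    using card_mono[OF finS, of R] by (auto simp: R_def)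
  have finR: "finite R"
    using finS by (simp add: R_def)
  have "\<forall>r\<in>R. \<exists>m. \<forall>t\<in>F r. length t = m"
    unfolding R_def F_def by fastforce
  then obtain l where l: "\<And>r t. r \<in> R \<Longrightarrow> t \<in> F r \<Longrightarrow> length t = l r"
    by metis
  have "\<And>r. r \<in> R \<Longrightarrow> finite (F r) \<and> N \<le> card (F r)"
    by (auto simp: R_def F_def level_of_def split: prod.split)
  with finR cardR l have "\<exists>p. \<forall>r\<in>R. p r \<in> F r \<and>
      (\<forall>q\<in>R. q \<noteq> r \<longrightarrow> \<not> (\<exists>y. extends y (p r) \<and> extends y (p q)))"
    by (rule incompatible_choice)
  then obtain p where p: "\<And>r. r \<in> R \<Longrightarrow> p r \<in> F r"
      "\<And>r q. r \<in> R \<Longrightarrow> q \<in> R \<Longrightarrow> q \<noteq> r \<Longrightarrow> \<not> (\<exists>y. extends y (p r) \<and> extends y (p q))"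
    by blast
  define A where "A = p ` {r \<in> R. snd (snd r)}"
  have "finite A"
    using finR by (simp add: A_def)
  then obtain n where n: "n \<notin> set xs" "\<And>y. cone_trace y n \<longleftrightarrow> (\<exists>t\<in>A. extends y t)"
    using ex_coordinate[of A "set xs"] by auto
  have "\<exists>t\<in>level_of c. forces t (xs @ [n]) (\<sigma> @ [b])"
    if "c \<in> W" "\<exists>m. \<forall>t\<in>level_of c. length t = m" "length \<sigma> = length xs"
      "N \<le> card {t \<in> level_of c. forces t xs \<sigma>}" for c \<sigma> b
  proof -
    have r: "(c, \<sigma>, b) \<in> R"
      using that by (auto simp: R_def S_def F_def)
    have "cone_trace y n = b" if y: "extends y (p (c, \<sigma>, b))" for y
    proof (cases b)
      case True
      then show ?thesis using r y n(2) by (auto simp: A_def)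
    next
      case False
      have "\<not> cone_trace y n"
      proof
        assume "cone_trace y n"
        then obtain q where "q \<in> R" "snd (snd q)" "extends y (p q)"
          using n(2) by (auto simp: A_def)
        then show False
          using p(2)[OF r, of q] y False by (metis snd_conv)
      qed
      then show ?thesis using False by simp
    qed
    then show ?thesis
      using p(1)[OF r] by (intro bexI[of _ "p (c, \<sigma>, b)"]) (auto simp: F_def forces_def)
  qed
  then show ?thesis
    using n(1) unfolding splits_next_def N_def by blast
qed

section \<open>The coordinates picked from a slalom\<close>

primrec picks :: "(nat \<rightharpoonup> nat set) \<Rightarrow> nat \<Rightarrow> nat list" where
  "picks w 0 = []"
| "picks w (Suc s) =
     picks w s @ [SOME n. splits_next (the (w (enumerate (dom w) s))) (picks w s) n]"

definition pick_set :: "(nat \<rightharpoonup> nat set) \<Rightarrow> nat set" where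
  "pick_set w = (\<Union>s. set (picks w s))"

lemma length_picks [simp]: "length (picks w s) = s"
  by (induction s) auto

lemma picks_Suc:
  assumes "w \<in> sPP_slaloms"
  obtains n where "picks w (Suc s) = picks w s @ [n]"
    "splits_next (the (w (enumerate (dom w) s))) (picks w s) n"
proof -
  have "finite (the (w (enumerate (dom w) s)))"
    using assms enumerate_in_set[of "dom w" s] unfolding sPP_slaloms_def by blast
  then show ?thesis
    using someI_ex[OF ex_splits_next[of _ "picks w s"]] by (intro that) auto
qed

lemma distinct_picks: "w \<in> sPP_slaloms \<Longrightarrow> distinct (picks w s)"
proof (induction s)
  case (Suc s)
  obtain n where "picks w (Suc s) = picks w s @ [n]"
    "splits_next (the (w (enumerate (dom w) s))) (picks w s) n"
    using picks_Suc[OF Suc.prems] .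
  then show ?case
    using Suc by (simp add: splits_next_def)
qed simp

lemma infinite_pick_set:
  assumes "w \<in> sPP_slaloms"
  shows "infinite (pick_set w)"
proof
  assume fin: "finite (pick_set w)"
  have "s \<le> card (pick_set w)" for s
    using card_mono[OF fin, of "set (picks w s)"] distinct_card[OF distinct_picks[OF assms, of s]]
    by (auto simp: pick_set_def)
  then show False
    using not_less_eq_eq by blast
qed

lemma set_picks_mono: "s \<le> s' \<Longrightarrow> set (picks w s) \<subseteq> set (picks w s')"
  by (rule lift_Suc_mono_le[of "\<lambda>s. set (picks w s)"]) auto

text \<open>Induction on the stage. A node at level \<open>m i\<close> forcing the current pattern
  has many extensions at level \<open>m (Suc i)\<close>, and all of them force it too. The true
  level is among the guesses of \<open>w\<close>, so by the choice of the next coordinate some node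
  of that level, not necessarily above the given one, forces the extended pattern.\<close>

lemma picks_realize:
  assumes w: "w \<in> sPP_slaloms"
    and ne: "R \<noteq> {}" and m: "mono m"
    and spl: "\<And>i y. y \<in> R \<Longrightarrow> Suc i * 2 ^ Suc i * 2 \<le>
                card ((\<lambda>z. init z (m (Suc i))) ` {z \<in> R. init z (m i) = init y (m i)})"
    and cap: "\<And>i. i \<in> dom w \<Longrightarrow>
                \<exists>c\<in>the (w i). level_of c = (\<lambda>y. init y (m i)) ` R"
    and "length \<sigma> = s"
  shows "\<exists>y\<in>R. map (cone_trace y) (picks w s) = \<sigma>"
proof -
  define b where "b = enumerate (dom w)"
  have inf: "infinite (dom w)"
    using w by (simp add: sPP_slaloms_def)
  have bdom: "b s \<in> dom w" for s
    using enumerate_in_set[OF inf] by (simp add: b_def)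
  have cW: "finite (the (w (b s)))" "card (the (w (b s))) = b s" for s
    using w bdom[of s] unfolding sPP_slaloms_def by blast+
  \<comment> \<open>At index 0 the slalom offers the empty set, which cannot contain a code of the
    true level.\<close>
  have bpos: "b s > 0" for s
    using cap[OF bdom[of s]] cW[of s] by (cases "b s = 0") auto
  \<comment> \<open>The pattern is forced already at level \<open>m (b s - 1)\<close>, which leaves
    the splitting between that level and the guessed level \<open>m (b s)\<close> for stage
    \<open>s\<close>.\<close>
  have "\<exists>y\<in>R. forces (init y (m (b s - 1))) (picks w s) \<sigma>" if "length \<sigma> = s" for s \<sigma>
    using that
  proof (induction s arbitrary: \<sigma>)
    case 0
    then show ?case
      using ne by (auto simp: forces_def)
  next
    case (Suc s)
    obtain n where n: "picks w (Suc s) = picks w s @ [n]"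
      "splits_next (the (w (b s))) (picks w s) n"
      using picks_Suc[OF w] unfolding b_def by blast
    obtain \<tau> e where \<sigma>: "\<sigma> = \<tau> @ [e]" "length \<tau> = s"
      using Suc.prems by (metis length_Suc_conv_rev)
    obtain y where y: "y \<in> R" "forces (init y (m (b s - 1))) (picks w s) \<tau>"
      using Suc.IH[OF \<sigma>(2)] by blast
    obtain c where c: "c \<in> the (w (b s))" "level_of c = (\<lambda>y. init y (m (b s))) ` R"
      using cap[OF bdom] by blast
    obtain i where i: "b s = Suc i"
      using bpos[of s] gr0_conv_Suc by blast
    let ?E = "(\<lambda>z. init z (m (Suc i))) ` {z \<in> R. init z (m i) = init y (m i)}"
    have le: "m i \<le> m (Suc i)"
      using m by (simp add: monoD)
    have "?E \<subseteq> {t \<in> level_of c. forces t (picks w s) \<tau>}"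
      using c(2) y(2) i forces_init_mono[OF _ le] by (auto simp: init_eq_iff)
    then have "card ?E \<le> card {t \<in> level_of c. forces t (picks w s) \<tau>}"
      by (rule card_mono[rotated]) (simp add: level_of_def)
    \<comment> \<open>There are \<open>Suc i\<close> guesses, and the \<open>s\<close>-th element of
      the domain is at least \<open>s\<close>, so a bound in terms of \<open>i\<close> alone covers
      the \<open>2 ^ s\<close> patterns.\<close>
    moreover have "card (the (w (b s))) * 2 ^ length (picks w s) * 2 \<le> Suc i * 2 ^ Suc i * 2"
    proof -
      have "s \<le> Suc i"
        using le_enumerate[OF inf, of s] i by (simp add: b_def)
      then show ?thesis
        using cW(2)[of s] i power_increasing[of s "Suc i" "2::nat"]
        by (simp add: mult_le_mono del: power_Suc mult_Suc)
    qed
    ultimately have "card (the (w (b s))) * 2 ^ length (picks w s) * 2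
        \<le> card {t \<in> level_of c. forces t (picks w s) \<tau>}"
      using spl[OF y(1), of i] by linarith
    moreover have "\<exists>k. \<forall>t\<in>level_of c. length t = k"
      using c(2) by auto
    ultimately have "\<exists>t\<in>level_of c. forces t (picks w s @ [n]) (\<tau> @ [e])"
      using n(2) c(1) \<sigma>(2) unfolding splits_next_def by auto
    then obtain z where z: "z \<in> R" "forces (init z (m (b s))) (picks w (Suc s)) \<sigma>"
      using c(2) n(1) \<sigma>(1) by auto
    have "b s < b (Suc s)"
      using enumerate_step[OF inf] by (simp add: b_def)
    then have "m (b s) \<le> m (b (Suc s) - 1)"
      using m by (intro monoD[OF m]) auto
    then show ?case
      using z forces_init_mono[of z "m (b s)" _ _ _ z] by blast
  qed
  then show ?thesis
    using forces_initD assms(6) by blast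
qed

section \<open>Levels with much splitting\<close>

lemma inj_on_init_eventually:
  assumes "finite S"
  shows "\<exists>k. \<forall>m\<ge>k. inj_on (\<lambda>y. init y m) S"
proof -
  have "\<forall>\<^sub>F m in sequentially. init y m \<noteq> init z m" if neq: "y \<noteq> z" for y z
  proof -
    obtain i where "y i \<noteq> z i"
      using neq by auto
    then show ?thesis
      by (intro eventually_sequentiallyI[of "Suc i"]) (metis init_eq_iff Suc_le_eq)
  qed
  then have "\<forall>\<^sub>F m in sequentially. \<forall>y\<in>S. \<forall>z\<in>S. y \<noteq> z \<longrightarrow> init y m \<noteq> init z m"
    using assms by (intro eventually_ball_finite ballI) (auto simp: eventually_mono)
  then show ?thesis
    unfolding eventually_sequentially inj_on_def by blast
qed

text \<open>\<open>N\<close> points of an infinite cone are separated at every sufficiently high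
  level; only finitely many nodes of level \<open>m\<close> have to be served, so one level serves
  them all.\<close>

lemma ex_splitting_level:
  assumes inf: "\<And>y m. y \<in> R \<Longrightarrow> infinite {z \<in> R. init z m = init y m}"
  shows "\<exists>m'\<ge>m. \<forall>y\<in>R. N \<le> card ((\<lambda>z. init z m') ` {z \<in> R. init z m = init y m})"
proof -
  have "\<forall>\<^sub>F m' in sequentially. N \<le> card ((\<lambda>z. init z m') ` {z \<in> R. init z m = t})"
    if "t \<in> (\<lambda>y. init y m) ` R" for t
  proof -
    obtain S where S: "S \<subseteq> {z \<in> R. init z m = t}" "finite S" "card S = N"
      using \<open>t \<in> _\<close> inf[of _ m] infinite_arbitrarily_large[of "{z \<in> R. init z m = t}" N] by blast
    obtain k where k: "\<And>m'. m' \<ge> k \<Longrightarrow> inj_on (\<lambda>y. init y m') S"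
      using inj_on_init_eventually[OF S(2)] by blast
    show ?thesis
    proof (rule eventually_sequentiallyI[of k])
      fix m' assume "k \<le> m'"
      then have "N = card ((\<lambda>z. init z m') ` S)"
        using card_image[OF k] S(3) by simp
      also have "\<dots> \<le> card ((\<lambda>z. init z m') ` {z \<in> R. init z m = t})"
        using S(1) by (intro card_mono finite_init_image) blast
      finally show "N \<le> card ((\<lambda>z. init z m') ` {z \<in> R. init z m = t})" .
    qed
  qed
  then have "\<forall>\<^sub>F m' in sequentially. \<forall>t\<in>(\<lambda>y. init y m) ` R.
      N \<le> card ((\<lambda>z. init z m') ` {z \<in> R. init z m = t})"
    by (intro eventually_ball_finite finite_init_image) blast
  then have "\<forall>\<^sub>F m' in sequentially. m \<le> m' \<and> (\<forall>t\<in>(\<lambda>y. init y m) ` R.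
      N \<le> card ((\<lambda>z. init z m') ` {z \<in> R. init z m = t}))"
    using eventually_ge_at_top[of m] by eventually_elim blast
  then show ?thesis
    unfolding eventually_sequentially by blast
qed

section \<open>Topology of the Cantor space and perfectness of the range of
  \<open>cone_trace\<close>\<close>

lemma open_coordinate: "open {y :: nat \<Rightarrow> bool. y i = b}"
proof -
  have "open ((\<lambda>y :: nat \<Rightarrow> bool. y i) -` {b})"
    by (intro open_vimage open_discrete continuous_on_product_coordinates)
  then show ?thesis
    by (simp add: vimage_def)
qed

lemma open_init_eq: "open {y. init y m = init z m}"
proof -
  have "{y. init y m = init z m} = (\<Inter>i\<in>{..<m}. {y. y i = z i})"
    by (auto simp: init_eq_iff)
  then show ?thesis
    by (simp add: open_INT open_coordinate)
qed

lemma continuous_trace: "continuous_on UNIV cone_trace"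
proof (rule continuous_on_coordinatewise_then_product)
  fix n
  define ts where "ts = snd (from_nat n :: nat \<times> bool list list)"
  \<comment> \<open>Each coordinate depends on finitely many bits of \<open>y\<close>. For an empty
    list this maximum is unspecified, but then the coordinate is constantly
    \<open>False\<close>.\<close>
  define m where "m = Max (length ` set ts)"
  have le: "length t \<le> m" if "t \<in> set ts" for t
    using that by (simp add: m_def)
  have loc: "cone_trace z n = cone_trace y n" if "init z m = init y m" for y z
    unfolding cone_trace_def ts_def[symmetric] extends_def using that le by (metis take_init)
  have "{z. init z m = init y m} \<subseteq> (\<lambda>y. cone_trace y n) -` B" if "cone_trace y n \<in> B" for y B
  proof
    fix z assume "z \<in> {z. init z m = init y m}"
    then show "z \<in> (\<lambda>y. cone_trace y n) -` B"
      using loc[of z y] that by simp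
  qed
  then have "open ((\<lambda>y. cone_trace y n) -` B)" for B
    by (subst open_subopen, intro ballI exI conjI) (auto intro: open_init_eq)
  then show "continuous_on UNIV (\<lambda>y. cone_trace y n)"
    by (simp add: continuous_on_open_vimage)
qed

text \<open>A basic neighbourhood of \<open>y\<close> can thus be read off from a single coordinate
  of the trace; this gives injectivity and transfers cones to open sets in the range.\<close>

lemma ex_coordinate_init: "\<exists>n. \<forall>z. cone_trace z n \<longleftrightarrow> init z m = init y m"
  using ex_coordinate[of "{init y m}" "{}"] by (auto simp: extends_def)

lemma inj_trace: "inj cone_trace"
proof (rule injI, rule ext)
  fix y z i assume eq: "cone_trace y = cone_trace z"
  obtain n where "\<And>x. cone_trace x n \<longleftrightarrow> init x (Suc i) = init y (Suc i)"
    using ex_coordinate_init by blast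
  then have "init z (Suc i) = init y (Suc i)"
    using eq by metis
  then show "y i = z i"
    by (simp add: init_eq_iff)
qed

lemma compact_Cantor: "compact (UNIV :: (nat \<Rightarrow> bool) set)"
proof -
  have "compactin (product_topology (\<lambda>i::nat. euclidean) UNIV) (\<Pi>\<^sub>E i\<in>UNIV. (UNIV :: bool set))"
    by (subst compactin_PiE) (auto intro: finite_imp_compact)
  then show ?thesis
    by (simp add: euclidean_product_topology PiE_UNIV_domain)
qed

lemma Hausdorff_Cantor: "Hausdorff_space (euclidean :: (nat \<Rightarrow> bool) topology)"
  unfolding Hausdorff_space_def
proof (intro allI impI)
  fix y z :: "nat \<Rightarrow> bool"
  assume "y \<in> topspace euclidean \<and> z \<in> topspace euclidean \<and> y \<noteq> z"
  then obtain i where "y i \<noteq> z i" by auto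
  then show "\<exists>U V. openin euclidean U \<and> openin euclidean V \<and> y \<in> U \<and> z \<in> V \<and> disjnt U V"
    by (intro exI[of _ "{x. x i = y i}"] exI[of _ "{x. x i = z i}"])
      (auto simp: open_coordinate disjnt_def)
qed

lemma islimpt_Cantor: "(y :: nat \<Rightarrow> bool) islimpt UNIV"
proof (rule islimptI)
  fix U :: "(nat \<Rightarrow> bool) set" assume "y \<in> U" "open U"
  then obtain X where X: "y \<in> Pi\<^sub>E UNIV X" "finite {i. X i \<noteq> UNIV}" "Pi\<^sub>E UNIV X \<subseteq> U"
    using product_topology_open_contains_basis[of "\<lambda>_. euclidean" UNIV U y]
    by (auto simp: euclidean_product_topology)
  obtain k where "X k = UNIV"
    using ex_new_if_finite[OF infinite_UNIV_nat X(2)] by blast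
  \<comment> \<open>A basic open set does not restrict coordinate \<open>k\<close>, so flipping it
    stays inside.\<close>
  then have "y(k := \<not> y k) \<in> U"
    using X by (auto simp: PiE_iff)
  moreover have "y(k := \<not> y k) \<noteq> y"
    by (metis fun_upd_same)
  ultimately show "\<exists>z\<in>UNIV. z \<in> U \<and> z \<noteq> y"
    by blast
qed

text \<open>The continuous injection \<open>cone_trace\<close> carries over compactness, hence
  closedness of the range, and the absence of isolated points.\<close>

lemma perfect_range_trace: "perfect_set (range cone_trace)"
  unfolding perfect_set_def
proof (intro conjI ballI)
  show "closed (range cone_trace)"
    using compactin_imp_closedin[OF Hausdorff_Cantor]
      compact_continuous_image[OF continuous_trace compact_Cantor] by simp
next
  fix x assume "x \<in> range cone_trace"
  then obtain y where y: "x = cone_trace y" by blast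
  show "x islimpt range cone_trace"
  proof (rule islimptI)
    fix U assume "x \<in> U" "open U"
    then have "open (cone_trace -` U)" "y \<in> cone_trace -` U"
      using continuous_trace y by (auto intro: open_vimage)
    then obtain z where "z \<in> cone_trace -` U" "z \<noteq> y"
      using islimpt_Cantor[of y] by (meson islimptE)
    then show "\<exists>y\<in>range cone_trace. y \<in> U \<and> y \<noteq> x"
      using y inj_trace by (auto simp: inj_eq)
  qed
qed auto

section \<open>Compactness and the comparison of the two cardinals\<close>

lemma restr_pick_set:
  assumes w: "w \<in> sPP_slaloms" and cl: "closed P"
    and fin: "\<And>s \<sigma>. length \<sigma> = s \<Longrightarrow> \<exists>g\<in>P. map g (picks w s) = \<sigma>"
  shows "restr_set P (pick_set w) = pick_set w \<rightarrow>\<^sub>E (UNIV :: bool set)"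
proof
  show "pick_set w \<rightarrow>\<^sub>E UNIV \<subseteq> restr_set P (pick_set w)"
  proof
    fix f :: "nat \<Rightarrow> bool" assume f: "f \<in> pick_set w \<rightarrow>\<^sub>E UNIV"
    \<comment> \<open>These sets are closed, nonempty by \<open>fin\<close>, and decreasing in
      \<open>s\<close>; a common point agrees with \<open>f\<close> on all of
      \<open>pick_set w\<close>.\<close>
    define C where "C s = {g \<in> P. \<forall>n\<in>set (picks w s). g n = f n}" for s
    have "- {g :: nat \<Rightarrow> bool. g n = f n} = {g. g n = (\<not> f n)}" for n
      by auto
    then have "closed {g :: nat \<Rightarrow> bool. g n = f n}" for n
      using open_coordinate by (simp add: closed_def)
    moreover have "C s = P \<inter> (\<Inter>n\<in>set (picks w s). {g. g n = f n})" for s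
      by (auto simp: C_def)
    ultimately have closed_C: "closed (C s)" for s
      using cl by (simp add: closed_INT closed_Int)
    have fip_C: "UNIV \<inter> (\<Inter>s\<in>I. C s) \<noteq> {}" if "finite I" for I
    proof -
      obtain k where "\<And>s. s \<in> I \<Longrightarrow> s \<le> k"
        using \<open>finite I\<close> by (auto simp: finite_nat_set_iff_bounded_le)
      then have "C k \<subseteq> (\<Inter>s\<in>I. C s)"
        using set_picks_mono by (fastforce simp: C_def)
      moreover have "C k \<noteq> {}"
        using fin[of "map f (picks w k)" k] by (auto simp: C_def)
      ultimately show ?thesis
        by blast
    qed
    have "UNIV \<inter> (\<Inter>s\<in>UNIV. C s) \<noteq> {}"
      using closed_C fip_C by (rule compact_imp_fip_image[OF compact_Cantor])
    then obtain g where g: "\<And>s. g \<in> C s"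
      by blast
    have "g \<in> P" "\<forall>n\<in>pick_set w. f n = g n"
      using g by (auto simp: C_def pick_set_def)
    then show "f \<in> restr_set P (pick_set w)"
      using f by (auto simp: restr_set_def)
  qed
qed (auto simp: restr_set_def)

text \<open>The cone corresponds to a piece of \<open>P\<close> cut out by one coordinate, an open
  condition, and in a Hausdorff space every neighbourhood of a limit point of \<open>P\<close> meets
  \<open>P\<close> in an infinite set.\<close>

lemma perfect_infinite_cone:
  assumes P: "perfect_set P" "P \<subseteq> range cone_trace" and y: "cone_trace y \<in> P"
  shows "infinite {z. cone_trace z \<in> P \<and> init z m = init y m}"
proof -
  obtain n where n: "\<And>z. cone_trace z n \<longleftrightarrow> init z m = init y m"
    using ex_coordinate_init by blast
  have "cone_trace y islimpt P"
    using P y by (simp add: perfect_set_def)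
  then have "cone_trace y \<in> euclidean derived_set_of P"
    by (auto simp: derived_set_of_def islimpt_def)
  then have "infinite (P \<inter> {g. g n = True})"
    using n open_coordinate[of n True]
    unfolding derived_set_of_infinite_openin[OF Hausdorff_Cantor] by auto
  moreover have "P \<inter> {g. g n = True} \<subseteq> cone_trace ` {z. cone_trace z \<in> P \<and> init z m = init y m}"
    using P(2) n by auto
  ultimately show ?thesis
    by (meson finite_imageI finite_subset)
qed

text \<open>The range of \<open>cone_trace\<close> serves as \<open>Q\<close> for every
  \<open>D\<close>. A perfect \<open>P\<close> inside it is pulled back to \<open>R\<close>, and a
  slalom in \<open>D\<close> capturing the codes of the levels of \<open>R\<close> supplies the
  required set.\<close>

lemma BP_family_picks:
  assumes D: "D \<subseteq> sPP_slaloms" "\<And>\<eta>. \<exists>w\<in>D. (\<eta>, w) \<in> R_sPP"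
  shows "pick_set ` D \<in> BP_families"
proof -
  have "\<exists>X\<in>pick_set ` D. restr_set P X = X \<rightarrow>\<^sub>E UNIV"
    if P: "perfect_set P" "P \<subseteq> range cone_trace" for P
  proof -
    define R where "R = {y. cone_trace y \<in> P}"
    have split_level: "\<exists>m'\<ge>m. \<forall>y\<in>R. N \<le> card ((\<lambda>z. init z m') ` {z \<in> R. init z m = init y m})" for m N
      using perfect_infinite_cone[OF P] by (intro ex_splitting_level) (auto simp: R_def)
    define nxt where "nxt N m = (SOME m'. m' \<ge> m \<and>
      (\<forall>y\<in>R. N \<le> card ((\<lambda>z. init z m') ` {z \<in> R. init z m = init y m})))" for N m
    have nxt: "m \<le> nxt N m"
      "\<And>y. y \<in> R \<Longrightarrow> N \<le> card ((\<lambda>z. init z (nxt N m)) ` {z \<in> R. init z m = init y m})" for m N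
      using someI_ex[OF split_level[of m N]] unfolding nxt_def by auto
    \<comment> \<open>Each step of the recursion provides exactly the amount of splitting that
      \<open>picks_realize\<close> asks for.\<close>
    define m where "m = rec_nat 0 (\<lambda>i. nxt (Suc i * 2 ^ Suc i * 2))"
    have m_Suc: "m (Suc i) = nxt (Suc i * 2 ^ Suc i * 2) (m i)" for i
      by (simp add: m_def)
    have "mono m"
      using nxt(1) by (intro incseq_SucI) (simp add: m_Suc)
    have "\<forall>i. \<exists>c. level_of c = (\<lambda>y. init y (m i)) ` R"
      by (intro allI ex_level_code finite_init_image)
    then obtain \<eta> where \<eta>: "\<And>i. level_of (\<eta> i) = (\<lambda>y. init y (m i)) ` R"
      by metis
    obtain w where w: "w \<in> D" "(\<eta>, w) \<in> R_sPP"
      using D(2) by blast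
    have ws: "w \<in> sPP_slaloms"
      using w D(1) by blast
    have "R \<noteq> {}"
      using P by (auto simp: R_def perfect_set_def)
    have "\<exists>g\<in>P. map g (picks w s) = \<sigma>" if "length \<sigma> = s" for s \<sigma>
    proof -
      have "\<exists>y\<in>R. map (cone_trace y) (picks w s) = \<sigma>"
      proof (rule picks_realize[OF ws \<open>R \<noteq> {}\<close> \<open>mono m\<close> _ _ that])
        show "\<exists>c\<in>the (w i). level_of c = (\<lambda>y. init y (m i)) ` R" if "i \<in> dom w" for i
          using w(2) that \<eta> unfolding R_sPP_def by blast
      qed (simp only: m_Suc nxt)
      then show ?thesis
        by (auto simp: R_def)
    qed
    then have "restr_set P (pick_set w) = pick_set w \<rightarrow>\<^sub>E UNIV"
      using P(1) by (intro restr_pick_set ws) (auto simp: perfect_set_def)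
    then show ?thesis
      using w(1) by blast
  qed
  then show ?thesis
    using perfect_range_trace infinite_pick_set D(1) unfolding BP_families_def by blast
qed

text \<open>Shows that the family minimized in \<open>d_R_sPP\<close> is nonempty, so that its least
  cardinality is attained. Index 0 is left out of the domain because a set of size 0 captures
  nothing.\<close>

lemma ex_sPP_slalom: "\<exists>w\<in>sPP_slaloms. (\<eta>, w) \<in> R_sPP"
proof -
  define w where "w = (\<lambda>i. if i = 0 then None else Some {\<eta> i..<\<eta> i + i})"
  have dom: "dom w = {0<..}"
    by (auto simp: w_def dom_def)
  have w: "w \<in> sPP_slaloms"
    unfolding sPP_slaloms_def using dom by (auto simp: w_def infinite_Ioi)
  moreover have "(\<eta>, w) \<in> R_sPP"
    using w dom by (auto simp: R_sPP_def w_def)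
  ultimately show ?thesis
    by blast
qed

theorem theorem7p1p3:
  shows "kappa_BP \<le>o d_R_sPP"
proof -
  let ?F = "{D. D \<subseteq> sPP_slaloms \<and> (\<forall>\<eta>. \<exists>w\<in>D. (\<eta>, w) \<in> R_sPP)}"
  have "sPP_slaloms \<in> ?F"
    using ex_sPP_slalom by blast
  then have "d_R_sPP \<in> card_of ` ?F"
    using least_card[of ?F] unfolding d_R_sPP_def by blast
  then obtain D where D: "D \<in> ?F" "d_R_sPP = |D|"
    by blast
  then have K: "pick_set ` D \<in> BP_families"
    by (intro BP_family_picks) auto
  then have "kappa_BP \<le>o |pick_set ` D|"
    using least_card[of BP_families] unfolding kappa_BP_def by blast
  also have "|pick_set ` D| \<le>o |D|"
    by (rule card_of_image)
  finally show ?thesis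
    using D(2) by simp
qed

end
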